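(* Let $h:\mathcal{D}\times\mathbb{R}_{\ge 0}\to\mathbb{R}$ be a $C^2$ function that has relative degree two with respect to the uncertain dynamics $\dot x=f(x)+g(x)(u+w)$, let $\alpha>0$, $\theta\in[0,1)$, $u_{\max}>0$, and let the Euclidean norm of the control input be bounded by $u_{\max}$, i.e. $\mathcal{U}=\{u\in\mathbb{R}^m:\|u\|_2\le u_{\max}\}$. Then for $(x,t)\in\mathcal{D}\times\mathbb{R}_{\ge 0}$ the RTVCBF-SOCP problem at $(x,t)$ is feasible if and only if $$u_{\max}\ \ge\ -\frac{c_1(x,t)}{(1-\theta)\,\|c_2(x,t)\|_2},$$ where $c_1(x,t)=\bar L_f^2h(x,t)+2\alpha\bar L_fh(x,t)+\alpha^2h(x,t)$ and $c_2(x,t)=L_g\bar L_fh(x,t)$.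
   Context: Setting: $\mathcal{D}\subseteq\mathbb{R}^n$ is the (open) set of admissible states and $\mathcal{R}$ the set of reference values; $f:\mathcal{D}\to\mathbb{R}^n$ and $g:\mathcal{D}\to\mathbb{R}^{n\times m}$ are locally Lipschitz continuous, and smooth enough that the iterated Lie derivatives below are defined (in particular $\bar L_fh$ is $C^1$). $k_0:\mathcal{D}\times\mathcal{R}\to\mathcal{U}$ is a given (Lipschitz) baseline controller; $w$ is a perturbation with $\|w\|_2\le\theta\|u\|_2$. Modified Lie derivatives: $L_f h=\frac{\partial h}{\partial x}f$, $L_g h=\frac{\partial h}{\partial x}g$ (a row vector in $\mathbb{R}^{1\times m}$), and $\bar L_f^i h=\left(\frac{\partial}{\partial t}+L_f\right)^i h$; thus $\bar L_f h=\frac{\partial h}{\partial t}+\frac{\partial h}{\partial x}f$, $\bar L_f^2h=\bar L_f(\bar L_fh)$, and $L_g\bar L_fh=\frac{\partial(\bar L_fh)}{\partial x}g$. Relative degree two: $L_gh(x,t)=0$ and $L_g\bar L_fh(x,t)\ne 0$ for all $(x,t)\in\mathcal{D}\times\mathbb{R}_{\ge 0}$. RTVCBF-SOCP at $(x,t)$ (with reference value $r\in\mathcal{R}$): minimize $q-k_0(x,r)^\top u$ over $u\in\mathcal{U}$, $q\in\mathbb{R}_{\ge 0}$ subject to $$\theta\|L_g\bar L_fh(x,t)\|_2\|u\|_2\le\bar L_f^2h(x,t)+2\alpha\bar L_fh(x,t)+\alpha^2h(x,t)+L_g\bar L_fh(x,t)\,u,\qquad \left\|\begin{bmatrix}\sqrt2\,u\\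 q-1\end{bmatrix}\right\|_2\le q+1.$$ The problem is feasible if there exist $u\in\mathcal{U}$ and $q\ge 0$ satisfying both constraints. *)

theory Defs
  imports "HOL-Analysis.Analysis"
begin

(* Derivatives are taken within S, hence one-sided at the boundary of S.  On
   S = D \<times> {0..} with D open they are unique. *)
definition C1_on :: "'a::real_normed_vector set \<Rightarrow> ('a \<Rightarrow> 'b::real_normed_vector) \<Rightarrow> bool" where
  "C1_on S F \<longleftrightarrow>
     (\<exists>F' :: 'a \<Rightarrow> 'a \<Rightarrow>\<^sub>L 'b.
        (\<forall>z\<in>S. (F has_derivative blinfun_apply (F' z)) (at z within S)) \<and> continuous_on S F')"

definition C2_on :: "'a::real_normed_vector set \<Rightarrow> ('a \<Rightarrow> 'b::real_normed_vector) \<Rightarrow> bool" where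
  "C2_on S F \<longleftrightarrow>
     (\<exists>F' :: 'a \<Rightarrow> 'a \<Rightarrow>\<^sub>L 'b.
        (\<forall>z\<in>S. (F has_derivative blinfun_apply (F' z)) (at z within S)) \<and> C1_on S F')"

(* Row vectors in R^(1 x k) are represented by elements of real ^ 'k: the product of a row
   vector with a column vector is the inner product, with a matrix it is v*. *)
definition partial_x :: "((real ^ 'n) \<times> real \<Rightarrow> real) \<Rightarrow> (real ^ 'n) \<times> real \<Rightarrow> real ^ 'n" where
  "partial_x h = (\<lambda>(x, t). \<chi> i. frechet_derivative (\<lambda>y. h (y, t)) (at x) (axis i 1))"

(* Time ranges over {0..}, so this is the right derivative at t = 0. *)
definition partial_t :: "((real ^ 'n) \<times> real \<Rightarrow> real) \<Rightarrow> (real ^ 'n) \<times> real \<Rightarrow> real" where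
  "partial_t h = (\<lambda>(x, t). vector_derivative (\<lambda>s. h (x, s)) (at t within {0..}))"

definition lie_f :: "(real ^ 'n \<Rightarrow> real ^ 'n) \<Rightarrow> ((real ^ 'n) \<times> real \<Rightarrow> real) \<Rightarrow>
    (real ^ 'n) \<times> real \<Rightarrow> real" where
  "lie_f f h = (\<lambda>(x, t). partial_x h (x, t) \<bullet> f x)"

definition lie_g :: "(real ^ 'n \<Rightarrow> real ^ 'm ^ 'n) \<Rightarrow> ((real ^ 'n) \<times> real \<Rightarrow> real) \<Rightarrow>
    (real ^ 'n) \<times> real \<Rightarrow> real ^ 'm" where
  "lie_g g h = (\<lambda>(x, t). partial_x h (x, t) v* g x)"

(* The modified Lie derivative d/dt + L_f; its i-th iterate is lie_bar f ^^ i. *)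
definition lie_bar :: "(real ^ 'n \<Rightarrow> real ^ 'n) \<Rightarrow> ((real ^ 'n) \<times> real \<Rightarrow> real) \<Rightarrow>
    (real ^ 'n) \<times> real \<Rightarrow> real" where
  "lie_bar f h = (\<lambda>z. partial_t h z + lie_f f h z)"

definition relative_degree_two :: "(real ^ 'n) set \<Rightarrow> (real ^ 'n \<Rightarrow> real ^ 'n) \<Rightarrow>
    (real ^ 'n \<Rightarrow> real ^ 'm ^ 'n) \<Rightarrow> ((real ^ 'n) \<times> real \<Rightarrow> real) \<Rightarrow> bool" where
  "relative_degree_two D f g h \<longleftrightarrow>
     (\<forall>z \<in> D \<times> {0..}. lie_g g h z = 0 \<and> lie_g g (lie_bar f h) z \<noteq> 0)"

record 'z min_problem =
  objective :: "'z \<Rightarrow> real"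
  constraint_set :: "'z set"

definition feasible :: "'z min_problem \<Rightarrow> bool" where
  "feasible P \<longleftrightarrow> (\<exists>z. z \<in> constraint_set P)"

(* Decision variable (u, q).  The norm on the product type is the Euclidean norm of the
   stacked vector. *)
definition rtvcbf_socp :: "(real ^ 'm) set \<Rightarrow> (real ^ 'n \<Rightarrow> real ^ 'n) \<Rightarrow>
    (real ^ 'n \<Rightarrow> real ^ 'm ^ 'n) \<Rightarrow> ((real ^ 'n) \<times> real \<Rightarrow> real) \<Rightarrow>
    (real ^ 'n \<Rightarrow> 'r \<Rightarrow> real ^ 'm) \<Rightarrow> real \<Rightarrow> real \<Rightarrow>
    real ^ 'n \<Rightarrow> real \<Rightarrow> 'r \<Rightarrow> ((real ^ 'm) \<times> real) min_problem" where
  "rtvcbf_socp U f g h k0 \<theta> \<alpha> x t r =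
     \<lparr> objective = (\<lambda>(u, q). q - k0 x r \<bullet> u),
       constraint_set = {(u, q). u \<in> U \<and> q \<ge> 0 \<and>
         \<theta> * norm (lie_g g (lie_bar f h) (x, t)) * norm u
           \<le> (lie_bar f ^^ 2) h (x, t) + 2 * \<alpha> * lie_bar f h (x, t) + \<alpha>\<^sup>2 * h (x, t)
              + lie_g g (lie_bar f h) (x, t) \<bullet> u \<and>
         norm (sqrt 2 *\<^sub>R u, q - 1) \<le> q + 1} \<rparr>"

end

theory Submission
  imports Defs
begin

text \<open>
  With \<open>q = \<parallel>u\<parallel>\<^sup>2 / 2\<close> the second cone constraint can always be met, so only the first one
  restricts \<open>u\<close>. By Cauchy-Schwarz, its slack among all \<open>u\<close> of a given norm is largest when \<open>u\<close> is a
  positive multiple of \<open>c2\<close>. Since \<open>\<theta> < 1\<close> the slack then increases with the norm of \<open>u\<close>, so the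
  problem is feasible exactly when \<open>u = umax c2 / \<parallel>c2\<parallel>\<close> satisfies the constraint.
\<close>

text \<open>Both sides of the cone inequality are nonnegative, so it may be squared; then
  \<open>(q + 1)\<^sup>2 - (q - 1)\<^sup>2 = 4 * q\<close> leaves a rotated second-order
  cone.\<close>

lemma rotated_cone_iff:
  fixes u :: "'a::real_normed_vector" and q :: real
  assumes "q \<ge> 0"
  shows "norm (sqrt 2 *\<^sub>R u, q - 1) \<le> q + 1 \<longleftrightarrow> (norm u)\<^sup>2 \<le> 2 * q"
proof -
  have "norm (sqrt 2 *\<^sub>R u, q - 1) \<le> q + 1 \<longleftrightarrow> 2 * (norm u)\<^sup>2 + (q - 1)\<^sup>2 \<le> (q + 1)\<^sup>2"
    using assms by (simp add: norm_Pair power_mult_distrib real_sqrt_le_iff' real_le_lsqrt)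
  also have "\<dots> \<longleftrightarrow> (norm u)\<^sup>2 \<le> 2 * q"
    by (simp add: power2_eq_square algebra_simps)
  finally show ?thesis .
qed

text \<open>The geometric core, with \<open>b\<close>, \<open>c\<close>, \<open>M\<close> standing
  for \<open>c2\<close>, \<open>c1\<close>, \<open>umax\<close> at a fixed point. Both sides reduce
  to one division-free inequality.\<close>

lemma robust_halfspace_meets_ball_iff:
  fixes b :: "'a::real_inner" and c M \<theta> :: real
  assumes "b \<noteq> 0" "\<theta> < 1" "0 \<le> M"
  shows "(\<exists>u. norm u \<le> M \<and> \<theta> * norm b * norm u \<le> c + b \<bullet> u) \<longleftrightarrow>
    - (c / ((1 - \<theta>) * norm b)) \<le> M"
proof -
  have pos: "(1 - \<theta>) * norm b > 0"
    using assms by simp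
  have "(\<exists>u. norm u \<le> M \<and> \<theta> * norm b * norm u \<le> c + b \<bullet> u) \<longleftrightarrow> - c \<le> M * ((1 - \<theta>) * norm b)"
  proof
    assume "\<exists>u. norm u \<le> M \<and> \<theta> * norm b * norm u \<le> c + b \<bullet> u"
    then obtain u where u: "norm u \<le> M" "\<theta> * norm b * norm u \<le> c + b \<bullet> u"
      by blast
    have "- c \<le> b \<bullet> u - \<theta> * norm b * norm u"
      using u(2) by linarith
    also have "\<dots> \<le> norm u * ((1 - \<theta>) * norm b)"
      using norm_cauchy_schwarz[of b u] by (simp add: algebra_simps)
    \<comment> \<open>Here \<theta> < 1 enters: the factor of \<open>norm u\<close> is positive, so
      \<open>norm u\<close> may be raised to \<open>M\<close>.\<close>
    also have "\<dots> \<le> M * ((1 - \<theta>) * norm b)"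
      using u(1) pos by (intro mult_right_mono) auto
    finally show "- c \<le> M * ((1 - \<theta>) * norm b)" .
  next
    assume le: "- c \<le> M * ((1 - \<theta>) * norm b)"
    \<comment> \<open>The point of the ball where Cauchy-Schwarz is an equality and the norm is
      maximal, so both estimates above become sharp.\<close>
    define u where "u = (M / norm b) *\<^sub>R b"
    have "norm u = M" "b \<bullet> u = M * norm b"
      using assms by (simp_all add: u_def dot_square_norm power2_eq_square)
    then show "\<exists>u. norm u \<le> M \<and> \<theta> * norm b * norm u \<le> c + b \<bullet> u"
      using le by (intro exI[of _ u]) (simp add: algebra_simps)
  qed
  also have "\<dots> \<longleftrightarrow> - (c / ((1 - \<theta>) * norm b)) \<le> M"
    using pos_divide_le_eq[OF pos, of "- c" M] by simp
  finally show ?thesis .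
qed

text \<open>Eliminates \<open>q\<close>: it occurs only in its sign condition and the second cone,
  and has no upper bound.\<close>

lemma feasible_rtvcbf_socp_iff:
  "feasible (rtvcbf_socp U f g h k0 \<theta> \<alpha> x t r) \<longleftrightarrow>
    (\<exists>u\<in>U. \<theta> * norm (lie_g g (lie_bar f h) (x, t)) * norm u
      \<le> (lie_bar f ^^ 2) h (x, t) + 2 * \<alpha> * lie_bar f h (x, t) + \<alpha>\<^sup>2 * h (x, t)
         + lie_g g (lie_bar f h) (x, t) \<bullet> u)"
  (is "_ \<longleftrightarrow> (\<exists>u\<in>U. ?P u)")
proof
  assume "feasible (rtvcbf_socp U f g h k0 \<theta> \<alpha> x t r)"
  then show "\<exists>u\<in>U. ?P u"
    by (auto simp: feasible_def rtvcbf_socp_def)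
next
  assume "\<exists>u\<in>U. ?P u"
  then obtain u where u: "u \<in> U" "?P u"
    by blast
  \<comment> \<open>By \<open>rotated_cone_iff\<close> this is the least admissible \<open>q\<close>
    for the given \<open>u\<close>.\<close>
  have "norm (sqrt 2 *\<^sub>R u, (norm u)\<^sup>2 / 2 - 1) \<le> (norm u)\<^sup>2 / 2 + 1"
    by (subst rotated_cone_iff) simp_all
  then have "(u, (norm u)\<^sup>2 / 2) \<in> constraint_set (rtvcbf_socp U f g h k0 \<theta> \<alpha> x t r)"
    using u by (simp add: rtvcbf_socp_def)
  then show "feasible (rtvcbf_socp U f g h k0 \<theta> \<alpha> x t r)"
    unfolding feasible_def by blast
qed

theorem theorem3:
  fixes D :: "(real ^ 'n) set"
    and R :: "'r::metric_space set"
    and U :: "(real ^ 'm) set"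
    and f :: "real ^ 'n \<Rightarrow> real ^ 'n"
    and g :: "real ^ 'n \<Rightarrow> real ^ 'm ^ 'n"
    and h :: "(real ^ 'n) \<times> real \<Rightarrow> real"
    and k0 :: "real ^ 'n \<Rightarrow> 'r \<Rightarrow> real ^ 'm"
    and c1 :: "(real ^ 'n) \<times> real \<Rightarrow> real"
    and c2 :: "(real ^ 'n) \<times> real \<Rightarrow> real ^ 'm"
    and \<alpha> \<theta> umax t :: real
    and x :: "real ^ 'n"
    and r :: 'r
  assumes "open D"
    and "local_lipschitz {0::real..} D (\<lambda>_. f)"
    and "local_lipschitz {0::real..} D (\<lambda>_. g)"
    and "C2_on (D \<times> {0..}) h"
    and "C1_on (D \<times> {0..}) (lie_bar f h)"
    and "relative_degree_two D f g h"
    and "\<alpha> > 0" and "0 \<le> \<theta>" and "\<theta> < 1" and "umax > 0"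
    and "U = {u. norm u \<le> umax}"
    and "\<And>y s. y \<in> D \<Longrightarrow> s \<in> R \<Longrightarrow> k0 y s \<in> U"
    and "\<exists>L. L-lipschitz_on (D \<times> R) (\<lambda>(y, s). k0 y s)"
    and "c1 = (\<lambda>z. (lie_bar f ^^ 2) h z + 2 * \<alpha> * lie_bar f h z + \<alpha>\<^sup>2 * h z)"
    and "c2 = lie_g g (lie_bar f h)"
    and "x \<in> D" and "t \<ge> 0" and "r \<in> R"
  shows "feasible (rtvcbf_socp U f g h k0 \<theta> \<alpha> x t r) \<longleftrightarrow>
           umax \<ge> - (c1 (x, t) / ((1 - \<theta>) * norm (c2 (x, t))))"
proof -
  \<comment> \<open>Relative degree two, used at the single point \<open>(x, t)\<close>, makes the
    denominator nonzero.\<close>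
  have "c2 (x, t) \<noteq> 0"
    using assms(6,15-17) by (auto simp: relative_degree_two_def)
  then show ?thesis
    using robust_halfspace_meets_ball_iff[of "c2 (x, t)" \<theta> umax "c1 (x, t)"] assms(9-11,14,15)
    by (simp add: feasible_rtvcbf_socp_iff)
qed

end
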